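(* Let $a, b, c$ be nonzero integers such that $-ab$ is not a perfect square and $\gcd(a,b,c)=1$, and let $X, Y \in M_2(\mathbb{Z})$. Then $aX^2 + bY^2 = cI$ and $XY = YX$ if and only if one of the following holds: (i) $X = t_1 I$ and $Y = t_2 I$, where $t_1, t_2 \in \mathbb{Z}$ satisfy $a t_1^2 + b t_2^2 = c$; (ii) $X = t_1 I$ and $Y = \begin{pmatrix} t_4 & t_2 \\ t_3 & -t_4 \end{pmatrix}$, where $t_1, t_2, t_3, t_4 \in \mathbb{Z}$ satisfy $a t_1^2 + b(t_4^2 + t_2 t_3) = c$; (iii) $X = \begin{pmatrix} t_1 & \frac{u-c}{g} t_2 \\ \frac{u-c}{g} t_3 & \frac{u t_1 + vb t_4}{c} \end{pmatrix}$ and $Y = \begin{pmatrix} t_4 & \frac{va}{g} t_2 \\ \frac{va}{g} t_3 & \frac{va t_1 - u t_4}{c} \end{pmatrix}$, where $t_1, t_2, t_3, t_4, u, v \in \mathbb{Z}$, $u \neq c$, $g = \gcd(va, u-c)$, and $$u^2 + v^2 ab = c^2, \quad a t_1^2 + b t_4^2 + \frac{2ac\, t_2 t_3}{g^2}(c-u) = c, \quad c \mid (u t_1 + vb t_4), \quad c \mid (va t_1 - u t_4).$$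
   Context: $M_2(\mathbb{Z})$ denotes the ring of $2\times 2$ matrices with integer entries; $I$ is the $2\times 2$ identity matrix. *)

theory Defs
  imports "Jordan_Normal_Form.Matrix" "HOL-Computational_Algebra.Nth_Powers"
begin

abbreviation mat2 :: "int \<Rightarrow> int \<Rightarrow> int \<Rightarrow> int \<Rightarrow> int mat" where
  "mat2 p q r s \<equiv> mat_of_rows_list 2 [[p, q], [r, s]]"

end

theory Submission
  imports Defs
begin

text \<open>
  Commuting integer matrices \<open>X\<close>, \<open>Y\<close> with \<open>X\<close> not scalar can be written as
  \<open>X = x\<^sub>4 I + p N\<close> and \<open>Y = y\<^sub>4 I + q N\<close> with \<open>p\<close>, \<open>q\<close> coprime and \<open>N = (d, r; s, 0)\<close>.
  Put \<open>n = a p\<^sup>2 + b q\<^sup>2\<close>, which is nonzero because \<open>-ab\<close> is not a square.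
  As \<open>N\<^sup>2 = d N + r s I\<close>, the matrix equation says \<open>a x\<^sub>4\<^sup>2 + b y\<^sub>4\<^sup>2 + r s n = c\<close> and
  \<open>n d = -2 (a p x\<^sub>4 + b q y\<^sub>4)\<close>. The second equation means that \<open>(x\<^sub>4, y\<^sub>4)\<close> is the
  reflection of the other pair \<open>(x\<^sub>1, y\<^sub>1)\<close> of diagonal entries along \<open>(p, q)\<close> with respect to the
  form \<open>a x\<^sup>2 + b y\<^sup>2\<close>. Multiplying this reflection by \<open>c\<close> makes it integral:
  \<open>n\<close> divides \<open>2 a c p\<^sup>2\<close> and \<open>2 c p q\<close>, and the entries of the resulting matrix are \<open>u\<close>, \<open>v b\<close>,
  \<open>v a\<close>, \<open>-u\<close> with \<open>u = c - 2 a c p\<^sup>2 / n\<close> and \<open>v = -2 c p q / n\<close>.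
\<close>

section \<open>Entrywise arithmetic of 2 x 2 integer matrices\<close>

lemma mat2_carrier: "mat2 p q r s \<in> carrier_mat 2 2"
  by (auto simp: mat_of_rows_list_def)

lemma mat2_eq_iff: "mat2 p q r s = mat2 p' q' r' s' \<longleftrightarrow> p = p' \<and> q = q' \<and> r = r' \<and> s = s'"
proof
  assume eq: "mat2 p q r s = mat2 p' q' r' s'"
  have "mat2 p q r s $$ (i, j) = mat2 p' q' r' s' $$ (i, j)" for i j
    by (simp only: eq)
  from this[of 0 0] this[of 0 1] this[of 1 0] this[of 1 1]
  show "p = p' \<and> q = q' \<and> r = r' \<and> s = s'"
    by (simp add: mat_of_rows_list_def)
qed simp

lemma mat2_cases:
  fixes X :: "int mat"
  assumes "X \<in> carrier_mat 2 2"
  obtains p q r s where "X = mat2 p q r s"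
proof
  show "X = mat2 (X $$ (0,0)) (X $$ (0,1)) (X $$ (1,0)) (X $$ (1,1))"
    using assms by (intro eq_matI) (auto simp: mat_of_rows_list_def less_Suc_eq numeral_2_eq_2)
qed

lemma mat2_add: "mat2 p q r s + mat2 p' q' r' s' = mat2 (p + p') (q + q') (r + r') (s + s')"
  by (intro eq_matI) (auto simp: mat_of_rows_list_def less_Suc_eq numeral_2_eq_2)

lemma mat2_smult: "k \<cdot>\<^sub>m mat2 p q r s = mat2 (k * p) (k * q) (k * r) (k * s)"
  by (intro eq_matI) (auto simp: mat_of_rows_list_def less_Suc_eq numeral_2_eq_2)

lemma mat2_one: "1\<^sub>m 2 = mat2 1 0 0 1"
  by (intro eq_matI) (auto simp: mat_of_rows_list_def less_Suc_eq numeral_2_eq_2)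

lemma mat2_mult: "mat2 p q r s * mat2 p' q' r' s' =
    mat2 (p * p' + q * r') (p * q' + q * s') (r * p' + s * r') (r * q' + s * s')"
  by (intro eq_matI) (auto simp: mat_of_rows_list_def less_Suc_eq numeral_2_eq_2 scalar_prod_def)

lemma mat2_power2: "mat2 p q r s ^\<^sub>m 2 =
    mat2 (p * p + q * r) (p * q + q * s) (r * p + s * r) (r * q + s * s)"
proof -
  have "mat2 p q r s ^\<^sub>m 2 = 1\<^sub>m (dim_row (mat2 p q r s)) * mat2 p q r s * mat2 p q r s"
    by (simp add: numeral_2_eq_2)
  also have "\<dots> = mat2 p q r s * mat2 p q r s"
    using mat2_carrier[of p q r s] by simp
  finally show ?thesis by (simp only: mat2_mult)
qed

lemmas mat2_simps = mat2_add mat2_smult mat2_one mat2_mult mat2_power2 mat2_eq_iff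

text \<open>Both diagonal entries of the commutator give \<open>x2 * y3 = y2 * x3\<close>. The three
  commutation equations say that (\<open>x2\<close>, \<open>x3\<close>, \<open>x1 - x4\<close>) and
  (\<open>y2\<close>, \<open>y3\<close>, \<open>y1 - y4\<close>) are linearly dependent.\<close>

lemma commuting_square_sum_mat2_iff:
  "(a \<cdot>\<^sub>m (mat2 x1 x2 x3 x4 ^\<^sub>m 2) + b \<cdot>\<^sub>m (mat2 y1 y2 y3 y4 ^\<^sub>m 2) = c \<cdot>\<^sub>m 1\<^sub>m 2 \<and>
    mat2 x1 x2 x3 x4 * mat2 y1 y2 y3 y4 = mat2 y1 y2 y3 y4 * mat2 x1 x2 x3 x4) \<longleftrightarrow>
   a * (x1^2 + x2 * x3) + b * (y1^2 + y2 * y3) = c \<and>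
   a * (x4^2 + x2 * x3) + b * (y4^2 + y2 * y3) = c \<and>
   a * x2 * (x1 + x4) + b * y2 * (y1 + y4) = 0 \<and>
   a * x3 * (x1 + x4) + b * y3 * (y1 + y4) = 0 \<and>
   x2 * y3 = y2 * x3 \<and> x2 * (y1 - y4) = y2 * (x1 - x4) \<and> x3 * (y1 - y4) = y3 * (x1 - x4)"
proof -
  have
    "a * (x1 * x2 + x2 * x4) + b * (y1 * y2 + y2 * y4) = c * 0 \<longleftrightarrow>
      a * x2 * (x1 + x4) + b * y2 * (y1 + y4) = 0"
    "a * (x3 * x1 + x4 * x3) + b * (y3 * y1 + y4 * y3) = c * 0 \<longleftrightarrow>
      a * x3 * (x1 + x4) + b * y3 * (y1 + y4) = 0"
    "x1 * y1 + x2 * y3 = y1 * x1 + y2 * x3 \<longleftrightarrow> x2 * y3 = y2 * x3"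
    "x1 * y2 + x2 * y4 = y1 * x2 + y2 * x4 \<longleftrightarrow> x2 * (y1 - y4) = y2 * (x1 - x4)"
    "x3 * y1 + x4 * y3 = y3 * x1 + y4 * x3 \<longleftrightarrow> x3 * (y1 - y4) = y3 * (x1 - x4)"
    "x3 * y2 + x4 * y4 = y3 * x2 + y4 * x4 \<longleftrightarrow> x2 * y3 = y2 * x3"
    "a * (x3 * x2 + x4 * x4) + b * (y3 * y2 + y4 * y4) = c * 1 \<longleftrightarrow>
      a * (x4 * x4 + x2 * x3) + b * (y4 * y4 + y2 * y3) = c"
    by (auto simp: algebra_simps)
  then show ?thesis
    unfolding mat2_simps power2_eq_square mult_1_right by blast
qed

section \<open>Coprime pairs, the binary form and its scaled reflection\<close>

lemma coprime_proportional:
  fixes p q w z :: int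
  assumes "coprime p q" and "p \<noteq> 0" and "p * z = q * w"
  obtains k where "w = p * k" and "z = q * k"
proof -
  have "p dvd q * w" by (simp flip: assms(3))
  then have "p dvd w" using assms(1) by (simp add: coprime_dvd_mult_right_iff)
  then obtain k where k: "w = p * k" ..
  with assms have "z = q * k" by (simp add: algebra_simps)
  with k show ?thesis by (rule that)
qed

text \<open>A zero of the form would make \<open>- (a * b)\<close> the square of the rational a p /
  q, hence of an integer.\<close>

lemma diagonal_form_nonzero:
  fixes a b p q :: int
  assumes "a \<noteq> 0" and "\<not> is_square (- (a * b))" and "p \<noteq> 0"
  shows "a * p^2 + b * q^2 \<noteq> 0"
proof
  assume 0: "a * p^2 + b * q^2 = 0"
  have sq: "(a * p)^2 = - (a * b) * q^2"
    using arg_cong[OF 0, of "\<lambda>x. a * x"] by (simp add: algebra_simps power2_eq_square)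
  have "q \<noteq> 0" using sq assms by auto
  have "q^2 dvd (a * p)^2" by (simp add: sq)
  then have "q dvd a * p" by simp
  then obtain k where "a * p = q * k" ..
  with sq have "- (a * b) * q^2 = k^2 * q^2" by (simp only: power_mult_distrib mult.commute)
  with \<open>q \<noteq> 0\<close> have "- (a * b) = k^2" by (metis mult_right_cancel power_not_zero)
  with assms(2) show False by (metis is_nth_power_nth_power)
qed

text \<open>After substituting for \<open>c\<close>, the part without \<open>r * s * n\<close>
  equals, up to multiples of \<open>n\<close>, a multiple of \<open>a * p * x + b * q * y\<close>,
  whose double is \<open>- n * d\<close>. This yields the explicit cofactors in the proof.\<close>

lemma reflection_integral:
  fixes a b p q :: int
  defines "n \<equiv> a * p^2 + b * q^2"
  assumes d: "n * d = - 2 * (a * p * x + b * q * y)"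
    and c: "a * x^2 + b * y^2 + r * s * n = c"
  shows "n dvd 2 * a * c * p^2" and "n dvd 2 * c * p * q"
proof -
  have "2 * a * c * p^2 = n * (2 * a * r * s * p^2 - a * p * x * d + b * q * y * d + 2 * b * y^2)"
    using d c unfolding n_def by Groebner_Basis.algebra
  then show "n dvd 2 * a * c * p^2" by simp
  have "2 * c * p * q = n * (2 * p * q * r * s - q * x * d - p * y * d - 2 * x * y)"
    using d c unfolding n_def by Groebner_Basis.algebra
  then show "n dvd 2 * c * p * q" by simp
qed

text \<open>The matrix with rows (\<open>u\<close>, \<open>v * b\<close>) and (\<open>v * a\<close>,
  \<open>- u\<close>) is \<open>c\<close> times the reflection along (\<open>p\<close>,
  \<open>q\<close>), which sends (\<open>x + p * d\<close>, \<open>y + q * d\<close>) to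
  (\<open>x\<close>, \<open>y\<close>). Its determinant is \<open>- c^2\<close>, whence the equation
  for \<open>u\<close> and \<open>v\<close>.\<close>

lemma reflection_parameters:
  fixes a b c p q :: int
  defines "n \<equiv> a * p^2 + b * q^2"
  assumes "n \<noteq> 0" and "coprime p q"
    and d: "n * d = - 2 * (a * p * x + b * q * y)"
    and c: "a * x^2 + b * y^2 + r * s * n = c"
  obtains u v k where "u - c = k * p" and "v * a = k * q" and "k * n = - 2 * a * c * p"
    and "u^2 + v^2 * a * b = c^2"
    and "c * x = u * (x + p * d) + v * b * (y + q * d)"
    and "c * y = v * a * (x + p * d) - u * (y + q * d)"
proof -
  obtain e where e: "2 * a * c * p^2 = n * e"
    using reflection_integral(1)[OF d[unfolded n_def] c[unfolded n_def]] unfolding n_def by (elim dvdE)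
  obtain f where f: "2 * c * p * q = n * f"
    using reflection_integral(2)[OF d[unfolded n_def] c[unfolded n_def]] unfolding n_def by (elim dvdE)
  obtain \<alpha> \<beta> where bez: "\<alpha> * p + \<beta> * q = 1"
    using \<open>coprime p q\<close> bezout_int[of p q] by auto
  \<comment> \<open>The common factor of \<open>u - c\<close> and \<open>v * a\<close> should be
    -2acp/n. As \<open>e\<close> and \<open>a * f\<close> are 2acp/n times \<open>p\<close> and
    \<open>q\<close>, the Bezout combination shows that it is an integer.\<close>
  define u v k where "u = c - e" and "v = - f" and "k = - (\<alpha> * e + \<beta> * a * f)"
  have cancel: "s = t" if "n * s = n * t" for s t
    using that \<open>n \<noteq> 0\<close> by simp
  have kn: "k * n = - 2 * a * c * p"
    using e f bez unfolding k_def by Groebner_Basis.algebra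
  have un: "n * u = c * (n - 2 * a * p^2)" and vn: "n * v = - 2 * c * p * q"
    using e f by (simp_all add: u_def v_def algebra_simps)
  show ?thesis
  proof (rule that[of u k v])
    show "u - c = k * p"
      by (rule cancel) (use kn un in Groebner_Basis.algebra)
    show "v * a = k * q"
      by (rule cancel) (use kn vn in Groebner_Basis.algebra)
    show "k * n = - 2 * a * c * p" by (fact kn)
    show "u^2 + v^2 * a * b = c^2"
      by (rule cancel, rule cancel) (use un vn n_def in Groebner_Basis.algebra)
    show "c * x = u * (x + p * d) + v * b * (y + q * d)"
      by (rule cancel) (use un vn d n_def in Groebner_Basis.algebra)
    show "c * y = v * a * (x + p * d) - u * (y + q * d)"
      by (rule cancel) (use un vn d n_def \<open>v * a = k * q\<close> in Groebner_Basis.algebra)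
  qed
qed

section \<open>Non-scalar \<open>X\<close>: from the matrix equations to case (iii)\<close>

lemma commuting_square_sum_imp_parameters:
  fixes a b c :: int
  assumes "a \<noteq> 0" and "c \<noteq> 0" and nsq: "\<not> is_square (- (a * b))"
    and eq1: "a * (x1^2 + x2 * x3) + b * (y1^2 + y2 * y3) = c"
    and eq4: "a * (x4^2 + x2 * x3) + b * (y4^2 + y2 * y3) = c"
    and eq2: "a * x2 * (x1 + x4) + b * y2 * (y1 + y4) = 0"
    and eq3: "a * x3 * (x1 + x4) + b * y3 * (y1 + y4) = 0"
    and comm: "x2 * y3 = y2 * x3" "x2 * (y1 - y4) = y2 * (x1 - x4)" "x3 * (y1 - y4) = y3 * (x1 - x4)"
    and nonscalar: "x2 \<noteq> 0 \<or> x3 \<noteq> 0 \<or> x1 \<noteq> x4"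
  obtains t2 t3 u v g where "u \<noteq> c" and "g = gcd (v * a) (u - c)"
    and "x2 = (u - c) div g * t2" and "x3 = (u - c) div g * t3"
    and "y2 = (v * a) div g * t2" and "y3 = (v * a) div g * t3"
    and "c * x4 = u * x1 + v * b * y1" and "c * y4 = v * a * x1 - u * y1"
    and "u^2 + v^2 * a * b = c^2"
    and "g^2 * (a * x1^2 + b * y1^2) + 2 * a * c * t2 * t3 * (c - u) = g^2 * c"
proof -
  \<comment> \<open>\<open>w\<close> is some nonzero entry of (\<open>x2\<close>, \<open>x3\<close>,
    \<open>x1 - x4\<close>) and \<open>z\<close> the matching one for \<open>Y\<close>, so that z/w
    is the ratio common to all three entries; q/p is this ratio in lowest terms.\<close>
  define w z where "w = (if x2 \<noteq> 0 then x2 else if x3 \<noteq> 0 then x3 else x1 - x4)"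
    and "z = (if x2 \<noteq> 0 then y2 else if x3 \<noteq> 0 then y3 else y1 - y4)"
  have "w \<noteq> 0" using nonscalar by (auto simp: w_def)
  have wz: "w * y2 = z * x2" "w * y3 = z * x3" "w * (y1 - y4) = z * (x1 - x4)"
    using comm by (auto simp: w_def z_def)
  define p q where "p = w div gcd w z" and "q = z div gcd w z"
  have w: "w = gcd w z * p" and z: "z = gcd w z * q"
    by (simp_all add: p_def q_def)
  have "coprime p q" unfolding p_def q_def using \<open>w \<noteq> 0\<close> by (intro div_gcd_coprime) simp
  have "p \<noteq> 0" using w \<open>w \<noteq> 0\<close> by auto
  have pq: "p * j = q * i" if "w * j = z * i" for i j
  proof -
    have "gcd w z * (p * j) = gcd w z * (q * i)"
      using that w z by (metis mult.assoc)
    then show ?thesis using \<open>w \<noteq> 0\<close> by simp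
  qed
  note split = coprime_proportional[OF \<open>coprime p q\<close> \<open>p \<noteq> 0\<close> pq]
  obtain r where r: "x2 = p * r" "y2 = q * r" by (rule split[OF wz(1)])
  obtain s where s: "x3 = p * s" "y3 = q * s" by (rule split[OF wz(2)])
  obtain d where d: "x1 - x4 = p * d" "y1 - y4 = q * d" by (rule split[OF wz(3)])
  define n where "n = a * p^2 + b * q^2"
  have "n \<noteq> 0" unfolding n_def by (rule diagonal_form_nonzero) fact+
  have x1: "x1 = x4 + p * d" and y1: "y1 = y4 + q * d" using d by simp_all
  \<comment> \<open>The off-diagonal equations are \<open>r\<close> and \<open>s\<close> times the
    claim. If both vanish, \<open>X\<close> is diagonal but not scalar, so \<open>d\<close> is
    nonzero, and the difference of the two diagonal equations is \<open>d\<close> times the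
    claim.\<close>
  have trace: "n * d = - 2 * (a * p * x4 + b * q * y4)"
  proof -
    have "t = 0 \<or> n * d = - 2 * (a * p * x4 + b * q * y4)"
      if "a * (p * t) * (x1 + x4) + b * (q * t) * (y1 + y4) = 0" for t
    proof -
      have "t * (n * d + 2 * (a * p * x4 + b * q * y4)) = a * (p * t) * (x1 + x4) + b * (q * t) * (y1 + y4)"
        by (simp add: x1 y1 n_def algebra_simps power2_eq_square)
      with that have "t * (n * d + 2 * (a * p * x4 + b * q * y4)) = 0"
        by simp
      then show ?thesis by auto
    qed
    then have "r = 0 \<and> s = 0 \<or> ?thesis"
      using eq2 eq3 r s by auto
    moreover have "?thesis" if "r = 0" "s = 0"
    proof -
      have "d \<noteq> 0" using nonscalar that r s d by auto
      moreover have "d * (n * d + 2 * (a * p * x4 + b * q * y4)) =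
          (a * x1^2 + b * y1^2) - (a * x4^2 + b * y4^2)"
        by (simp add: x1 y1 n_def algebra_simps power2_eq_square)
      then have "d * (n * d + 2 * (a * p * x4 + b * q * y4)) = 0"
        using eq1 eq4 that r s by simp
      ultimately show ?thesis by auto
    qed
    ultimately show ?thesis by blast
  qed
  have c: "a * x4^2 + b * y4^2 + r * s * n = c"
    using eq4 by (simp add: r s n_def algebra_simps power2_eq_square)
  obtain u v k where uvk: "u - c = k * p" "v * a = k * q" "k * n = - 2 * a * c * p"
      "u^2 + v^2 * a * b = c^2"
      "c * x4 = u * x1 + v * b * y1" "c * y4 = v * a * x1 - u * y1"
    using reflection_parameters[OF \<open>n \<noteq> 0\<close>[unfolded n_def] \<open>coprime p q\<close>
        trace[unfolded n_def] c[unfolded n_def], folded n_def x1 y1] by metis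
  have "k \<noteq> 0" using uvk(3) \<open>a \<noteq> 0\<close> \<open>c \<noteq> 0\<close> \<open>p \<noteq> 0\<close> by auto
  define g where "g = gcd (v * a) (u - c)"
  have g: "g = \<bar>k\<bar>"
    using \<open>coprime p q\<close> by (simp add: g_def uvk gcd_mult_distrib_int[symmetric] coprime_iff_gcd_eq_1 gcd.commute)
  have quot: "(u - c) div g = sgn k * p" "(v * a) div g = sgn k * q"
  proof -
    have "k * t = g * (sgn k * t)" for t by (simp add: g sgn_if)
    moreover have "g \<noteq> 0" using g \<open>k \<noteq> 0\<close> by simp
    ultimately show "(u - c) div g = sgn k * p" "(v * a) div g = sgn k * q"
      unfolding uvk(1,2) by (metis nonzero_mult_div_cancel_left)+
  qed
  have sgn: "sgn k * sgn k = 1" using \<open>k \<noteq> 0\<close> by (simp add: sgn_if)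
  show ?thesis
  \<comment> \<open>Division by \<open>g\<close> returns \<open>p\<close> and \<open>q\<close> only
    up to the sign of \<open>k\<close>; the witnesses for \<open>t2\<close> and \<open>t3\<close>
    absorb that sign.\<close>
  proof (rule that[of u g v "sgn k * r" "sgn k * s"])
    show "u \<noteq> c" using uvk(1) \<open>k \<noteq> 0\<close> \<open>p \<noteq> 0\<close> by auto
    show "g = gcd (v * a) (u - c)" by (fact g_def)
    \<comment> \<open>Here 2ac(c - u) = -2acpk = k^2 n, so the last condition is \<open>eq1\<close>
      multiplied by k^2.\<close>
    have "g^2 = k^2" by (simp add: g)
    then show "g^2 * (a * x1^2 + b * y1^2) + 2 * a * c * (sgn k * r) * (sgn k * s) * (c - u) = g^2 * c"
      using eq1 r s n_def uvk(1,3) sgn by Groebner_Basis.algebra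
    have "sgn k * t * (sgn k * t') = t * t'" for t t'
      using sgn by Groebner_Basis.algebra
    then show "x2 = (u - c) div g * (sgn k * r)" "x3 = (u - c) div g * (sgn k * s)"
      "y2 = (v * a) div g * (sgn k * r)" "y3 = (v * a) div g * (sgn k * s)"
      unfolding quot r s by simp_all
  qed (fact uvk)+
qed

section \<open>From case (iii) back to the matrix equations\<close>

lemma parameters_imp_commuting_square_sum:
  fixes a b c u v :: int
  defines "g \<equiv> gcd (v * a) (u - c)"
  assumes "c \<noteq> 0" and "u \<noteq> c"
    and x2: "x2 = (u - c) div g * t2" and x3: "x3 = (u - c) div g * t3"
    and y2: "y2 = (v * a) div g * t2" and y3: "y3 = (v * a) div g * t3"
    and x4: "c * x4 = u * x1 + v * b * y1" and y4: "c * y4 = v * a * x1 - u * y1"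
    and uv: "u^2 + v^2 * a * b = c^2"
    and eq: "g^2 * (a * x1^2 + b * y1^2) + 2 * a * c * t2 * t3 * (c - u) = g^2 * c"
  shows "a * (x1^2 + x2 * x3) + b * (y1^2 + y2 * y3) = c"
    and "a * (x4^2 + x2 * x3) + b * (y4^2 + y2 * y3) = c"
    and "a * x2 * (x1 + x4) + b * y2 * (y1 + y4) = 0"
    and "a * x3 * (x1 + x4) + b * y3 * (y1 + y4) = 0"
    and "x2 * y3 = y2 * x3" and "x2 * (y1 - y4) = y2 * (x1 - x4)" and "x3 * (y1 - y4) = y3 * (x1 - x4)"
proof -
  have "g \<noteq> 0" using \<open>u \<noteq> c\<close> by (simp add: g_def)
  define p q where "p = (u - c) div g" and "q = (v * a) div g"
  have p: "g * p = u - c" and q: "g * q = v * a"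
    by (simp_all add: p_def q_def g_def)
  have cancel_c: "i = j" if "c * i = c * j" for i j using that \<open>c \<noteq> 0\<close> by simp
  have cancel_g: "i = j" if "g * i = g * j" for i j using that \<open>g \<noteq> 0\<close> by simp
  \<comment> \<open>The matrix with rows (\<open>u\<close>, \<open>v * b\<close>) and
    (\<open>v * a\<close>, \<open>- u\<close>) multiplies the form by
    \<open>u^2 + v^2 * a * b\<close>, which is \<open>c^2\<close>.\<close>
  have norm: "a * x4^2 + b * y4^2 = a * x1^2 + b * y1^2"
    by (rule cancel_c, rule cancel_c) (use x4 y4 uv in Groebner_Basis.algebra)
  \<comment> \<open>As for any reflection along (\<open>p\<close>, \<open>q\<close>), the sum of a
    vector and its image is orthogonal to (\<open>p\<close>, \<open>q\<close>), and by
    \<open>par\<close> their difference is parallel to it.\<close>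
  have off: "a * p * (x1 + x4) + b * q * (y1 + y4) = 0"
    by (rule cancel_c, rule cancel_g) (use x4 y4 uv p q in Groebner_Basis.algebra)
  have par: "p * (y1 - y4) = q * (x1 - x4)"
    by (rule cancel_c, rule cancel_g) (use x4 y4 uv p q in Groebner_Basis.algebra)
  \<comment> \<open>By \<open>uv\<close>, g^2 (a p^2 + b q^2) = a ((u - c)^2 + v^2 a b) = 2ac(c -
    u), which turns \<open>eq\<close> into g^2 times the claim.\<close>
  have main: "a * x1^2 + b * y1^2 + t2 * t3 * (a * p^2 + b * q^2) = c"
    by (rule cancel_g, rule cancel_g) (use eq p q uv in Groebner_Basis.algebra)
  note defs = x2[folded p_def] x3[folded p_def] y2[folded q_def] y3[folded q_def]
  show "a * (x1^2 + x2 * x3) + b * (y1^2 + y2 * y3) = c"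
    using main unfolding defs by (simp add: algebra_simps power2_eq_square)
  show "a * (x4^2 + x2 * x3) + b * (y4^2 + y2 * y3) = c"
    using main norm unfolding defs by (simp add: algebra_simps power2_eq_square)
  show "a * x2 * (x1 + x4) + b * y2 * (y1 + y4) = 0"
    using off unfolding defs by Groebner_Basis.algebra
  show "a * x3 * (x1 + x4) + b * y3 * (y1 + y4) = 0"
    using off unfolding defs by Groebner_Basis.algebra
  show "x2 * y3 = y2 * x3" unfolding defs by simp
  show "x2 * (y1 - y4) = y2 * (x1 - x4)"
    using par unfolding defs by Groebner_Basis.algebra
  show "x3 * (y1 - y4) = y3 * (x1 - x4)"
    using par unfolding defs by Groebner_Basis.algebra
qed

text \<open>The quotient by g^2 in case (iii) is taken in the rationals; clearing it gives the
  integer equation of the two preceding lemmas.\<close>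

lemma rational_condition_iff:
  fixes g m k c w :: int
  assumes "g \<noteq> 0"
  shows "of_int m + of_int k / of_int (g^2) * of_int w = (of_int c :: rat) \<longleftrightarrow>
    g^2 * m + k * w = g^2 * c"
proof -
  have "of_int m + of_int k / of_int (g^2) * of_int w = (of_int c :: rat) \<longleftrightarrow>
      (of_int (g^2 * m + k * w) :: rat) = of_int (g^2 * c)"
    using assms by (simp add: field_simps)
  then show ?thesis by (simp only: of_int_eq_iff)
qed

section \<open>Assembly of the three cases\<close>

theorem theorem4p2:
  fixes a b c :: int and X Y :: "int mat"
  assumes "a \<noteq> 0" and "b \<noteq> 0" and "c \<noteq> 0"
    and "\<not> is_square (- (a * b))"
    and "gcd a (gcd b c) = 1"
    and "X \<in> carrier_mat 2 2" and "Y \<in> carrier_mat 2 2"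
  shows "(a \<cdot>\<^sub>m (X ^\<^sub>m 2) + b \<cdot>\<^sub>m (Y ^\<^sub>m 2) = c \<cdot>\<^sub>m 1\<^sub>m 2 \<and> X * Y = Y * X) \<longleftrightarrow>
    (\<exists>t1 t2 :: int.
        X = t1 \<cdot>\<^sub>m 1\<^sub>m 2 \<and> Y = t2 \<cdot>\<^sub>m 1\<^sub>m 2 \<and> a * t1^2 + b * t2^2 = c)
    \<or> (\<exists>t1 t2 t3 t4 :: int.
        X = t1 \<cdot>\<^sub>m 1\<^sub>m 2 \<and> Y = mat2 t4 t2 t3 (- t4) \<and> a * t1^2 + b * (t4^2 + t2 * t3) = c)
    \<or> (\<exists>t1 t2 t3 t4 u v :: int. u \<noteq> c \<and> (let g = gcd (v * a) (u - c) in
        X = mat2 t1 ((u - c) div g * t2)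
                 ((u - c) div g * t3) ((u * t1 + v * b * t4) div c) \<and>
        Y = mat2 t4 ((v * a) div g * t2)
                 ((v * a) div g * t3) ((v * a * t1 - u * t4) div c) \<and>
        u^2 + v^2 * a * b = c^2 \<and>
        (of_int (a * t1^2 + b * t4^2)
          + of_int (2 * a * c * t2 * t3) / of_int (g^2) * of_int (c - u) = (of_int c :: rat)) \<and>
        c dvd (u * t1 + v * b * t4) \<and>
        c dvd (v * a * t1 - u * t4)))"
  (is "?eqs \<longleftrightarrow> ?i \<or> ?ii \<or> ?iii")
proof -
  obtain x1 x2 x3 x4 where X: "X = mat2 x1 x2 x3 x4" using assms(6) by (rule mat2_cases)
  obtain y1 y2 y3 y4 where Y: "Y = mat2 y1 y2 y3 y4" using assms(7) by (rule mat2_cases)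
  note eqs_iff = commuting_square_sum_mat2_iff[of a x1 x2 x3 x4 b y1 y2 y3 y4 c, folded X Y]
  show ?thesis
  proof
    assume ?eqs
    then have eqs: "a * (x1^2 + x2 * x3) + b * (y1^2 + y2 * y3) = c"
        "a * (x4^2 + x2 * x3) + b * (y4^2 + y2 * y3) = c"
        "a * x2 * (x1 + x4) + b * y2 * (y1 + y4) = 0"
        "a * x3 * (x1 + x4) + b * y3 * (y1 + y4) = 0"
        "x2 * y3 = y2 * x3" "x2 * (y1 - y4) = y2 * (x1 - x4)" "x3 * (y1 - y4) = y3 * (x1 - x4)"
      unfolding eqs_iff by simp_all
    \<comment> \<open>A non-scalar \<open>X\<close> leads to (iii), two scalar matrices to (i), and
      a scalar \<open>X\<close> with non-scalar \<open>Y\<close> to (ii).\<close>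
    consider "x2 \<noteq> 0 \<or> x3 \<noteq> 0 \<or> x1 \<noteq> x4"
      | "x2 = 0" "x3 = 0" "x1 = x4" "y2 = 0" "y3 = 0" "y1 = y4"
      | "x2 = 0" "x3 = 0" "x1 = x4" "y2 \<noteq> 0 \<or> y3 \<noteq> 0 \<or> y1 \<noteq> y4" by blast
    then show "?i \<or> ?ii \<or> ?iii"
    proof cases
      case 1
      obtain t2 t3 u v g where *: "u \<noteq> c" "g = gcd (v * a) (u - c)"
          "x2 = (u - c) div g * t2" "x3 = (u - c) div g * t3"
          "y2 = (v * a) div g * t2" "y3 = (v * a) div g * t3"
          "c * x4 = u * x1 + v * b * y1" "c * y4 = v * a * x1 - u * y1"
          "u^2 + v^2 * a * b = c^2"
          "g^2 * (a * x1^2 + b * y1^2) + 2 * a * c * t2 * t3 * (c - u) = g^2 * c"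
        by (rule commuting_square_sum_imp_parameters[OF assms(1,3,4) eqs 1])
      have "g \<noteq> 0" using * by simp
      have "of_int (a * x1^2 + b * y1^2)
          + of_int (2 * a * c * t2 * t3) / of_int (g^2) * of_int (c - u) = (of_int c :: rat)"
        unfolding rational_condition_iff[OF \<open>g \<noteq> 0\<close>] by (fact *(10))
      moreover have "c dvd u * x1 + v * b * y1" "c dvd v * a * x1 - u * y1"
        by (metis *(7) dvd_triv_left) (metis *(8) dvd_triv_left)
      moreover have "x4 = (u * x1 + v * b * y1) div c" "y4 = (v * a * x1 - u * y1) div c"
        using \<open>c \<noteq> 0\<close> by (simp_all flip: *(7,8))
      ultimately have ?iii
        unfolding Let_def X Y mat2_eq_iff
        using *(1-6,9) by blast
      then show ?thesis by blast
    next
      case 2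
      with eqs have ?i unfolding X Y mat2_simps by auto
      then show ?thesis ..
    next
      case 3
      have "b * y1^2 = b * y4^2"
        using eqs(1,2) unfolding distrib_left 3(3) by linarith
      with \<open>b \<noteq> 0\<close> have "y1 = y4 \<or> y1 = - y4" by (simp add: power2_eq_iff)
      \<comment> \<open>If \<open>y1 = y4\<close>, then \<open>Y\<close> has a nonzero off-diagonal
        entry, and the matching off-diagonal equation forces trace zero anyway.\<close>
      with eqs(3,4) 3 \<open>b \<noteq> 0\<close> have "y4 = - y1" by auto
      with 3 eqs(1) have ?ii unfolding X Y mat2_simps by auto
      then show ?thesis by blast
    qed
  next
    assume "?i \<or> ?ii \<or> ?iii"
    then consider ?i | ?ii | ?iii by blast
    then show ?eqs
    proof cases
      case 1
      then show ?thesis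
        unfolding eqs_iff unfolding X Y mat2_simps by auto
    next
      case 2
      then show ?thesis
        unfolding eqs_iff unfolding X Y mat2_simps by (auto simp: power2_eq_square)
    next
      case 3
      then obtain t1 t2 t3 t4 u v where "u \<noteq> c" and
        *: "let g = gcd (v * a) (u - c) in
        X = mat2 t1 ((u - c) div g * t2)
                 ((u - c) div g * t3) ((u * t1 + v * b * t4) div c) \<and>
        Y = mat2 t4 ((v * a) div g * t2)
                 ((v * a) div g * t3) ((v * a * t1 - u * t4) div c) \<and>
        u^2 + v^2 * a * b = c^2 \<and>
        (of_int (a * t1^2 + b * t4^2)
          + of_int (2 * a * c * t2 * t3) / of_int (g^2) * of_int (c - u) = (of_int c :: rat)) \<and>
        c dvd (u * t1 + v * b * t4) \<and>
        c dvd (v * a * t1 - u * t4)"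
        by blast
      define g where "g = gcd (v * a) (u - c)"
      have "g \<noteq> 0" using \<open>u \<noteq> c\<close> by (simp add: g_def)
      note ** = *[unfolded Let_def, folded g_def,
          unfolded X Y mat2_eq_iff rational_condition_iff[OF \<open>g \<noteq> 0\<close>]]
      have "x2 = (u - c) div g * t2" "x3 = (u - c) div g * t3"
          "y2 = (v * a) div g * t2" "y3 = (v * a) div g * t3"
          "c * x4 = u * x1 + v * b * y1" "c * y4 = v * a * x1 - u * y1"
          "u^2 + v^2 * a * b = c^2"
          "g^2 * (a * x1^2 + b * y1^2) + 2 * a * c * t2 * t3 * (c - u) = g^2 * c"
        using ** by auto
      note parameters_imp_commuting_square_sum[OF \<open>c \<noteq> 0\<close> \<open>u \<noteq> c\<close> this[unfolded g_def]]
      then show ?thesis unfolding eqs_iff by blast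
    qed
  qed
qed

end
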